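(* Let $n\geq 3$ and let $\Gamma=(V,E)$ be a cubic graph. If there exists an $e'\in E$ such that $\Gamma\setminus e'$ (the graph obtained by deleting $e'$) has a nowhere-zero $n$-flow, then $\Gamma$ has a nowhere-identity dihedral $n$-flow for any embedding for which $e'$ is contained in a simple contractible cycle.
   Context: Graphs are finite and may have loops and parallel edges; $\Gamma$ is connected; cubic means every vertex has degree $3$. An embedding of $\Gamma=(V,E)$ is given by a rotation system $\pi=\{\pi_v\mid v\in V\}$, where $\pi_v$ is a cyclic order of the edges incident with $v$ (a loop appears twice); equivalently, it is a cellular embedding in a closed connected orientable surface $S$. A simple contractible cycle is a cycle of $\Gamma$ without repeated vertices that, viewed as a closed curve in $S$, is homotopic to a constant map (equivalently, it bounds a disk in $S$). For a group $G$ and an orientation of the edges, a $G$-flow is a map $f:E\to G$ such that at each vertex $v$ the product of the values of the incident edges, taken in the order $\pi_v$, is the identity, where the inverse $f(e)^{-1}$ is used for an edge leaving $v$. It is nowhere-identity if $f(e)\neq1$ for all $e$. Existence does not depend on the orientation. $\mathbb{D}=\{\begin{pmatrix}\pm1&a\\0&1\end{pmatrix}\mid a\in\mathbb{Z}\}$ and $\mathbb{D}^{<n}=\{\begin{pmatrix}\pm1&a\\0&1\end{pmatrix}\in\mathbb{D}\mid |a|<n\}$. A nowhere-identity dihedral $n$-flow is a nowhere-identity $\mathbb{D}$-flow with all values in $\mathbb{D}^{<n}$. A nowhere-zero $n$-flow on a graph is a $\mathbb{Z}$-flow (Kirchhoff's law with respect to some orientation) with values in $\{\pm1,\dots,\pm(n-1)\}$.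 *)

theory Defs
  imports "HOL-Analysis.Analysis" "HOL-Algebra.Group"
    "HOL-Combinatorics.Orbits" "Graph_Theory.Graph_Theory"
begin

text \<open>
  A finite undirected graph, possibly with loops and parallel edges, is a finite
  bidirected digraph \<open>G\<close> with arc reversal \<open>arev\<close>.  The arcs are the half-edges (darts):
  the undirected edges are the pairs \<open>{d, arev d}\<close>, and the arc \<open>d\<close> represents the
  half-edge of \<open>{d, arev d}\<close> at the vertex \<open>tail G d\<close>.  A loop contributes two distinct
  arcs to its vertex.
\<close>

definition arc_edge :: "('b \<Rightarrow> 'b) \<Rightarrow> 'b \<Rightarrow> 'b set" where
  "arc_edge arev d = {d, arev d}"

definition edges :: "('a, 'b) pre_digraph \<Rightarrow> ('b \<Rightarrow> 'b) \<Rightarrow> 'b set set" where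
  "edges G arev = arc_edge arev ` arcs G"

definition multigraph :: "('a, 'b) pre_digraph \<Rightarrow> ('b \<Rightarrow> 'b) \<Rightarrow> bool" where
  "multigraph G arev \<longleftrightarrow> fin_digraph G \<and> bidirected_digraph G arev"

definition cubic :: "('a, 'b) pre_digraph \<Rightarrow> bool" where
  "cubic G \<longleftrightarrow> (\<forall>v \<in> verts G. out_degree G v = 3)"

definition del_edge :: "('a, 'b) pre_digraph \<Rightarrow> 'b set \<Rightarrow> ('a, 'b) pre_digraph" where
  "del_edge G e = G\<lparr>arcs := arcs G - e\<rparr>"

text \<open>An orientation is given by the set of arcs that point in the chosen direction.\<close>

definition orientation :: "('a, 'b) pre_digraph \<Rightarrow> ('b \<Rightarrow> 'b) \<Rightarrow> 'b set \<Rightarrow> bool" where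
  "orientation G arev Or \<longleftrightarrow> Or \<subseteq> arcs G \<and> (\<forall>d \<in> arcs G. d \<in> Or \<longleftrightarrow> arev d \<notin> Or)"

definition nowhere_zero_flow ::
    "('a, 'b) pre_digraph \<Rightarrow> ('b \<Rightarrow> 'b) \<Rightarrow> nat \<Rightarrow> 'b set \<Rightarrow> ('b set \<Rightarrow> int) \<Rightarrow> bool" where
  "nowhere_zero_flow G arev n Or f \<longleftrightarrow>
     (\<forall>v \<in> verts G. (\<Sum>d \<in> in_arcs G v \<inter> Or. f (arc_edge arev d))
                   = (\<Sum>d \<in> out_arcs G v \<inter> Or. f (arc_edge arev d))) \<and>
     (\<forall>e \<in> edges G arev. f e \<noteq> 0 \<and> \<bar>f e\<bar> < int n)"

definition has_nowhere_zero_flow :: "('a, 'b) pre_digraph \<Rightarrow> ('b \<Rightarrow> 'b) \<Rightarrow> nat \<Rightarrow> bool" where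
  "has_nowhere_zero_flow G arev n \<longleftrightarrow>
     (\<exists>Or f. orientation G arev Or \<and> nowhere_zero_flow G arev n Or f)"

text \<open>
  A rotation system is encoded by the permutation \<open>\<sigma>\<close> of the arcs whose restriction to the
  arcs leaving \<open>v\<close> is the cyclic order at \<open>v\<close>.
\<close>

definition rotation_system :: "('a, 'b) pre_digraph \<Rightarrow> ('b \<Rightarrow> 'b) \<Rightarrow> bool" where
  "rotation_system G \<sigma> \<longleftrightarrow>
     \<sigma> permutes arcs G \<and>
     (\<forall>v \<in> verts G. out_arcs G v \<noteq> {} \<longrightarrow> cyclic_on \<sigma> (out_arcs G v))"

text \<open>
  The contribution of a half-edge to the product at its vertex.  An arc \<open>d \<in> Or\<close> leaves
  \<open>tail G d\<close>; if \<open>d \<notin> Or\<close>, then \<open>arev d \<in> Or\<close> enters \<open>tail G d\<close>.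
\<close>

definition half_edge_value ::
    "('g, 'm) monoid_scheme \<Rightarrow> ('b \<Rightarrow> 'b) \<Rightarrow> 'b set \<Rightarrow> ('b set \<Rightarrow> 'g) \<Rightarrow> 'b \<Rightarrow> 'g" where
  "half_edge_value M arev Or f d =
     (if d \<in> Or then inv\<^bsub>M\<^esub> f (arc_edge arev d) else f (arc_edge arev d))"

text \<open>
  The product at \<open>v\<close> is required to be the identity for every starting half-edge \<open>d\<close>;
  different starting points give conjugate products.
\<close>

definition group_flow ::
    "('g, 'm) monoid_scheme \<Rightarrow> ('a, 'b) pre_digraph \<Rightarrow> ('b \<Rightarrow> 'b) \<Rightarrow> ('b \<Rightarrow> 'b) \<Rightarrow> 'b set
      \<Rightarrow> ('b set \<Rightarrow> 'g) \<Rightarrow> bool" where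
  "group_flow M G arev \<sigma> Or f \<longleftrightarrow>
     (\<forall>e \<in> edges G arev. f e \<in> carrier M) \<and>
     (\<forall>v \<in> verts G. \<forall>d \<in> out_arcs G v.
        foldr (\<lambda>i x. half_edge_value M arev Or f ((\<sigma> ^^ i) d) \<otimes>\<^bsub>M\<^esub> x)
          [0..<out_degree G v] \<one>\<^bsub>M\<^esub> = \<one>\<^bsub>M\<^esub>)"

definition nowhere_identity ::
    "('g, 'm) monoid_scheme \<Rightarrow> ('a, 'b) pre_digraph \<Rightarrow> ('b \<Rightarrow> 'b) \<Rightarrow> ('b set \<Rightarrow> 'g) \<Rightarrow> bool" where
  "nowhere_identity M G arev f \<longleftrightarrow> (\<forall>e \<in> edges G arev. f e \<noteq> \<one>\<^bsub>M\<^esub>)"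

definition dihedral_matrix :: "int \<Rightarrow> int \<Rightarrow> int^2^2" where
  "dihedral_matrix s a = vector [vector [s, a], vector [0, 1]]"

definition dihedral_group :: "(int^2^2) monoid" where
  "dihedral_group =
     \<lparr>carrier = {dihedral_matrix s a | s a. s = 1 \<or> s = - 1}, mult = (**), one = mat 1\<rparr>"

lemma dihedral_matrix_mult:
  "dihedral_matrix s a ** dihedral_matrix t b = dihedral_matrix (s * t) (s * b + a)"
  by (simp add: dihedral_matrix_def matrix_matrix_mult_def vec_eq_iff forall_2 sum_2)

lemma dihedral_matrix_one: "mat 1 = dihedral_matrix 1 0"
  by (simp add: dihedral_matrix_def mat_def vec_eq_iff forall_2)

lemma group_dihedral_group: "group dihedral_group"
proof (rule groupI)
  fix x assume "x \<in> carrier dihedral_group"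
  then obtain s a where x: "x = dihedral_matrix s a" and s: "s = 1 \<or> s = - 1"
    by (auto simp: dihedral_group_def)
  then have "dihedral_matrix s (- s * a) \<otimes>\<^bsub>dihedral_group\<^esub> x = \<one>\<^bsub>dihedral_group\<^esub>"
    by (auto simp: dihedral_group_def dihedral_matrix_mult dihedral_matrix_one)
  then show "\<exists>y\<in>carrier dihedral_group. y \<otimes>\<^bsub>dihedral_group\<^esub> x = \<one>\<^bsub>dihedral_group\<^esub>"
    using s by (intro bexI[of _ "dihedral_matrix s (- s * a)"]) (auto simp: dihedral_group_def)
qed (auto 0 4 simp: dihedral_group_def dihedral_matrix_one dihedral_matrix_mult algebra_simps)

definition dihedral_below :: "nat \<Rightarrow> (int^2^2) set" where
  "dihedral_below n = {dihedral_matrix s a | s a. (s = 1 \<or> s = - 1) \<and> \<bar>a\<bar> < int n}"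

definition has_nowhere_identity_dihedral_flow ::
    "('a, 'b) pre_digraph \<Rightarrow> ('b \<Rightarrow> 'b) \<Rightarrow> ('b \<Rightarrow> 'b) \<Rightarrow> nat \<Rightarrow> bool" where
  "has_nowhere_identity_dihedral_flow G arev \<sigma> n \<longleftrightarrow>
     (\<exists>Or f. orientation G arev Or \<and> group_flow dihedral_group G arev \<sigma> Or f \<and>
        nowhere_identity dihedral_group G arev f \<and>
        (\<forall>e \<in> edges G arev. f e \<in> dihedral_below n))"

text \<open>
  The surface of a rotation system.  The facial walk through an arc \<open>d\<close> continues with
  \<open>\<sigma> (arev d)\<close>; the facial walks are the orbits of \<open>\<sigma> \<circ> arev\<close>.  Each facial walk is
  filled with a disk, presented as the cone over the walk: the arc \<open>d\<close> contributes the
  sector of points \<open>(d, t, s)\<close>, where \<open>t\<close> is the position along \<open>d\<close> from \<open>tail G d\<close> to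
  \<open>head G d\<close> and \<open>s\<close> is the height above \<open>d\<close>, the line \<open>s = 1\<close> being collapsed to the
  centre of the face.  The three parts of the gluing relation identify the two sides
  of each edge, glue consecutive sectors of a face, and collapse the line \<open>s = 1\<close>.
\<close>

definition sector_points :: "('a, 'b) pre_digraph \<Rightarrow> ('b \<times> real \<times> real) set" where
  "sector_points G = arcs G \<times> {0..1} \<times> {0..1}"

definition sectors :: "('a, 'b) pre_digraph \<Rightarrow> ('b \<times> real \<times> real) topology" where
  "sectors G =
     prod_topology (discrete_topology (arcs G)) (top_of_set ({0..1} \<times> {0..1}))"

definition gluing ::
    "('a, 'b) pre_digraph \<Rightarrow> ('b \<Rightarrow> 'b) \<Rightarrow> ('b \<Rightarrow> 'b) \<Rightarrow> ('b \<times> real \<times> real) rel" where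
  "gluing G arev \<sigma> =
     {((d, t, 0), (arev d, 1 - t, 0)) | d t. d \<in> arcs G \<and> t \<in> {0..1}} \<union>
     {((d, 1, s), (\<sigma> (arev d), 0, s)) | d s. d \<in> arcs G \<and> s \<in> {0..1}} \<union>
     {((d, t, 1), (d, t', 1)) | d t t'. d \<in> arcs G \<and> t \<in> {0..1} \<and> t' \<in> {0..1}}"

definition glued ::
    "('a, 'b) pre_digraph \<Rightarrow> ('b \<Rightarrow> 'b) \<Rightarrow> ('b \<Rightarrow> 'b) \<Rightarrow> ('b \<times> real \<times> real) rel" where
  "glued G arev \<sigma> =
     (gluing G arev \<sigma> \<union> (gluing G arev \<sigma>)\<inverse>)\<^sup>* \<inter> sector_points G \<times> sector_points G"

definition surface_point ::
    "('a, 'b) pre_digraph \<Rightarrow> ('b \<Rightarrow> 'b) \<Rightarrow> ('b \<Rightarrow> 'b) \<Rightarrow> 'b \<times> real \<times> real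
      \<Rightarrow> ('b \<times> real \<times> real) set" where
  "surface_point G arev \<sigma> x = glued G arev \<sigma> `` {x}"

definition surface ::
    "('a, 'b) pre_digraph \<Rightarrow> ('b \<Rightarrow> 'b) \<Rightarrow> ('b \<Rightarrow> 'b) \<Rightarrow> ('b \<times> real \<times> real) set topology" where
  "surface G arev \<sigma> =
     topology (\<lambda>U. U \<subseteq> sector_points G // glued G arev \<sigma> \<and> openin (sectors G) (\<Union>U))"

lemma topspace_sectors: "topspace (sectors G) = sector_points G"
  by (simp add: sectors_def sector_points_def)

lemma equiv_glued: "equiv (sector_points G) (glued G arev \<sigma>)"
proof (rule equivI)
  let ?r = "gluing G arev \<sigma> \<union> (gluing G arev \<sigma>)\<inverse>"
  have "sym (?r\<^sup>*)"
    by (intro sym_rtrancl) (auto simp: sym_def)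
  then show "sym (glued G arev \<sigma>)"
    by (auto simp: glued_def sym_def)
  show "refl_on (sector_points G) (glued G arev \<sigma>)"
    by (auto simp: glued_def refl_on_def)
  show "trans (glued G arev \<sigma>)"
    by (auto simp: glued_def trans_def intro: rtrancl_trans)
  show "glued G arev \<sigma> \<subseteq> sector_points G \<times> sector_points G"
    by (auto simp: glued_def)
qed

lemma openin_surface:
  "openin (surface G arev \<sigma>) U \<longleftrightarrow>
     U \<subseteq> sector_points G // glued G arev \<sigma> \<and> openin (sectors G) (\<Union>U)"
proof -
  let ?Q = "sector_points G // glued G arev \<sigma>"
  have int: "\<Union>(S \<inter> T) = \<Union>S \<inter> \<Union>T" if "S \<subseteq> ?Q" "T \<subseteq> ?Q" for S T
    using that quotient_disj[OF equiv_glued[of G arev \<sigma>]] by blast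
  have "openin (sectors G) (\<Union>(\<Union>\<K>))" if "\<forall>K\<in>\<K>. openin (sectors G) (\<Union>K)" for \<K>
  proof -
    have "\<Union>(\<Union>\<K>) = \<Union>(Union ` \<K>)" by blast
    then show ?thesis using that by (metis (no_types, lifting) imageE openin_Union)
  qed
  then have "istopology (\<lambda>U. U \<subseteq> ?Q \<and> openin (sectors G) (\<Union>U))"
    unfolding istopology_def by (intro conjI allI impI) (auto simp: int simp del: Union_iff)
  then show ?thesis
    by (simp add: surface_def)
qed

lemma topspace_surface: "topspace (surface G arev \<sigma>) = sector_points G // glued G arev \<sigma>"
proof -
  have "openin (surface G arev \<sigma>) (sector_points G // glued G arev \<sigma>)"
    unfolding openin_surface Union_quotient[OF equiv_glued]
    by (metis openin_topspace order_refl topspace_sectors)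
  then show ?thesis
    by (metis openin_subset openin_surface openin_topspace subset_antisym)
qed

lemma quotient_map_surface_point:
  "quotient_map (sectors G) (surface G arev \<sigma>) (surface_point G arev \<sigma>)"
proof -
  let ?q = "surface_point G arev \<sigma>"
  have img: "?q ` sector_points G = sector_points G // glued G arev \<sigma>"
    by (auto simp: surface_point_def quotient_def)
  have pre: "{x \<in> sector_points G. ?q x \<in> U} = \<Union>U"
    if "U \<subseteq> sector_points G // glued G arev \<sigma>" for U
  proof (intro equalityI subsetI)
    fix x assume "x \<in> {x \<in> sector_points G. ?q x \<in> U}"
    then show "x \<in> \<Union>U"
      using equiv_class_self[OF equiv_glued[of G arev \<sigma>], of x]
      unfolding surface_point_def by blast
  next
    fix x assume "x \<in> \<Union>U"
    then obtain C where C: "C \<in> U" "x \<in> C" by blast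
    with that obtain y where y: "C = glued G arev \<sigma> `` {y}"
      by (auto simp: quotient_def)
    then have "?q x = C"
      using C equiv_class_eq[OF equiv_glued[of G arev \<sigma>], of y x] by (auto simp: surface_point_def)
    moreover have "x \<in> sector_points G"
      using C y by (auto simp: glued_def)
    ultimately show "x \<in> {x \<in> sector_points G. ?q x \<in> U}"
      using C by simp
  qed
  show ?thesis
    unfolding quotient_map_def topspace_sectors topspace_surface openin_surface
    using img pre by auto
qed

text \<open>
  In a bidirected digraph the walk \<open>[d, arev d]\<close> is a directed cycle, so a cycle of the
  undirected graph must in addition not repeat an edge.  Loops and pairs of parallel
  edges are cycles.
\<close>

definition simple_cycle :: "('a, 'b) pre_digraph \<Rightarrow> ('b \<Rightarrow> 'b) \<Rightarrow> 'b list \<Rightarrow> bool" where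
  "simple_cycle G arev p \<longleftrightarrow> pre_digraph.cycle G p \<and> distinct (map (arc_edge arev) p)"

text \<open>The closed walk \<open>p\<close> as a loop in the surface, each arc taking time \<open>1 / length p\<close>.\<close>

definition walk_curve ::
    "('a, 'b) pre_digraph \<Rightarrow> ('b \<Rightarrow> 'b) \<Rightarrow> ('b \<Rightarrow> 'b) \<Rightarrow> 'b list
      \<Rightarrow> real \<Rightarrow> ('b \<times> real \<times> real) set" where
  "walk_curve G arev \<sigma> p x =
     (let y = x * real (length p)
      in surface_point G arev \<sigma> (p ! (nat \<lfloor>y\<rfloor> mod length p), frac y, 0))"

definition contractible_walk ::
    "('a, 'b) pre_digraph \<Rightarrow> ('b \<Rightarrow> 'b) \<Rightarrow> ('b \<Rightarrow> 'b) \<Rightarrow> 'b list \<Rightarrow> bool" where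
  "contractible_walk G arev \<sigma> p \<longleftrightarrow>
     (\<exists>c \<in> topspace (surface G arev \<sigma>).
        homotopic_with (\<lambda>\<gamma>. \<gamma> 0 = \<gamma> 1) (top_of_set {0..1}) (surface G arev \<sigma>)
          (walk_curve G arev \<sigma> p) (\<lambda>_. c))"

end

theory Submission
  imports Defs "HOL-Complex_Analysis.Winding_Numbers"
begin

text \<open>
  A contractible cycle \<open>C\<close> separates the surface: otherwise a closed curve in the dual graph
  crosses \<open>C\<close> exactly once, and counting signed crossings with it gives a map from the
  surface to the circle along which \<open>C\<close> has winding number \<open>1\<close>.  Extend the
  \<open>n\<close>-flow of \<open>\<Gamma> - e'\<close> by \<open>0\<close> on \<open>e'\<close>, assign reflections to the edges of
  \<open>C\<close> and translations to all other edges, and negate the flow on one side of \<open>C\<close>.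
  At a vertex of \<open>C\<close> the product of the two reflections depends on which of them comes first,
  that is, on the side to which the third edge points, and the negation on that side compensates
  exactly for this.
\<close>

section \<open>Dihedral matrices and cyclic orders of three elements\<close>

lemma dihedral_matrix_eq_iff [simp]:
  "dihedral_matrix s a = dihedral_matrix t b \<longleftrightarrow> s = t \<and> a = b"
  by (auto simp: dihedral_matrix_def vec_eq_iff forall_2)

text \<open>The first return time of \<open>d\<close> under \<open>f\<close> is the size of its
  orbit, hence 3.\<close>

lemma cyclic_on_card_3:
  assumes cyc: "cyclic_on f A" and card: "card A = 3" and d: "d \<in> A"
  shows "A = {d, f d, f (f d)}" and "f (f (f d)) = d"
proof -
  have A: "orbit f d = A" "d \<in> orbit f d"
    using orbit_cyclic_eq3[OF cyc d] d by simp_all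
  define n where "n = funpow_dist1 f d d"
  have n: "(f ^^ n) d = d" "0 < n"
    using funpow_dist1_prop[OF A(2)] by (auto simp: n_def)
  have "inj_on (\<lambda>m. (f ^^ m) d) {0..<n}"
    using inj_on_funpow_dist1[OF A(2)] by (simp add: n_def)
  then have "n = card ((\<lambda>m. (f ^^ m) d) ` {0..<n})"
    by (simp add: card_image)
  also have "\<dots> = 3"
    using orbit_conv_funpow_dist1[OF A(2)] card A(1) by (simp add: n_def)
  finally have 3: "n = 3" .
  show "f (f (f d)) = d"
    using n(1) by (simp add: 3 eval_nat_numeral)
  have "A = (\<lambda>m. (f ^^ m) d) ` {..<3}"
    using orbit_altdef_bounded[OF n] A(1) by (auto simp: 3)
  also have "{..<3} = {0, 1, 2 :: nat}"
    by auto
  finally show "A = {d, f d, f (f d)}"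
    by (simp add: numeral_2_eq_2)
qed

section \<open>Sides of edges and dual paths\<close>

locale embedded_multigraph = fin_digraph G + bidirected_digraph G arev
  for G :: "('a, 'b) pre_digraph" and arev :: "'b \<Rightarrow> 'b" +
  fixes \<sigma> :: "'b \<Rightarrow> 'b"
  assumes rotation: "rotation_system G \<sigma>"
begin

lemma rot_permutes: "\<sigma> permutes arcs G"
  using rotation by (simp add: rotation_system_def)

lemma facial_eq_iff [simp]: "\<sigma> (arev x) = \<sigma> (arev y) \<longleftrightarrow> x = y"
  by (metis arev_arev permutes_inj[OF rot_permutes] injD)

lemma arev_eq_iff: "arev x = y \<longleftrightarrow> x = arev y"
  by (metis arev_arev)

text \<open>
  The arc \<open>d\<close> stands for the side of its edge lying in the face of \<open>d\<close>: steps move along the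
  boundary of a face, or across an edge outside \<open>C\<close>.
\<close>

definition side_step :: "'b set \<Rightarrow> 'b rel" where
  "side_step C = {(x, y). y = \<sigma> (arev x) \<or> x = \<sigma> (arev y) \<or> y = arev x \<and> x \<notin> C}"

text \<open>
  Here \<open>\<phi>\<close> counts the signed crossings of each edge by the path from \<open>x\<close> to \<open>y\<close>, and
  \<open>u\<close> is a primitive of \<open>\<phi>\<close> along the facial walks, except for the jumps at the two ends.
\<close>

lemma side_path_potential:
  assumes "(x, y) \<in> (side_step C)\<^sup>*" and C: "\<And>d. d \<in> C \<Longrightarrow> arev d \<in> C"
  shows "\<exists>(u :: 'b \<Rightarrow> int) \<phi>. (\<forall>d. \<phi> (arev d) = - \<phi> d) \<and> (\<forall>d \<in> C. \<phi> d = 0) \<and>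
           (\<forall>d. u (\<sigma> (arev d)) - u d = \<phi> d - of_bool (d = x) + of_bool (d = y))"
  using assms(1)
proof (induction rule: rtrancl_induct)
  case base
  show ?case
    by (intro exI[of _ "\<lambda>_. 0"]) simp
next
  case (step y z)
  then obtain u \<phi> :: "'b \<Rightarrow> int" where anti: "\<And>d. \<phi> (arev d) = - \<phi> d"
    and zero: "\<And>d. d \<in> C \<Longrightarrow> \<phi> d = 0"
    and pot: "\<And>d. u (\<sigma> (arev d)) - u d = \<phi> d - of_bool (d = x) + of_bool (d = y)"
    by blast
  consider "z = \<sigma> (arev y)" | "y = \<sigma> (arev z)" | "z = arev y" "y \<notin> C"
    using step.hyps(2) by (auto simp: side_step_def)
  then show ?case
  proof cases
    \<comment> \<open>A step along a face changes only \<open>u\<close>: correcting its value at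
      \<open>z\<close> moves the jump from \<open>y\<close> to \<open>z\<close>.\<close>
    case 1
    have "u (\<sigma> (arev d)) - of_bool (\<sigma> (arev d) = z) - (u d - of_bool (d = z)) =
        \<phi> d - of_bool (d = x) + of_bool (d = z)" for d
      using pot[of d] by (simp add: 1)
    with anti zero show ?thesis
      by (intro exI[of _ "\<lambda>d. u d - of_bool (d = z)"] exI[of _ \<phi>]) simp
  next
    case 2
    have "u (\<sigma> (arev d)) + of_bool (\<sigma> (arev d) = y) - (u d + of_bool (d = y)) =
        \<phi> d - of_bool (d = x) + of_bool (d = z)" for d
      using pot[of d] by (simp add: 2)
    with anti zero show ?thesis
      by (intro exI[of _ "\<lambda>d. u d + of_bool (d = y)"] exI[of _ \<phi>]) simp
  next
    \<comment> \<open>A step across an edge changes only \<open>\<phi>\<close>, antisymmetrically.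
      Since \<open>C\<close> is closed under \<open>arev\<close>, both arcs of the crossed edge lie
      outside \<open>C\<close>, so \<open>\<phi>\<close> still vanishes on \<open>C\<close>.\<close>
    case 3
    have "d \<noteq> y" "d \<noteq> z" if "d \<in> C" for d
      using that 3 C[of "arev y"] by auto
    with anti zero pot show ?thesis
      by (intro exI[of _ u] exI[of _ "\<lambda>d. \<phi> d + of_bool (d = y) - of_bool (d = z)"])
        (auto simp: 3 arev_eq_iff)
  qed
qed

section \<open>Circle-valued maps on the surface\<close>

text \<open>The real exponent is affine along the arc, with initial value \<open>u d\<close> and
  slope \<open>v d\<close>, and is coned off to 0 at the centre of the face.\<close>

lemma continuous_map_sectors:
  fixes u v :: "'b \<Rightarrow> real"
  shows "continuous_map (sectors G) (top_of_set (- {0}))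
     (\<lambda>(d, t, s). exp (2 * pi * \<i> * complex_of_real ((1 - s) * (u d + v d * t))))"
proof -
  let ?X = "sectors G"
  have disc: "continuous_map ?X euclideanreal (\<lambda>x. w (fst x))" for w :: "'b \<Rightarrow> real"
    unfolding sectors_def
    by (intro continuous_map_compose[OF continuous_map_fst, unfolded comp_def]) auto
  have snd: "continuous_map ?X (top_of_set ({0..1} \<times> {0..1})) (snd :: 'b \<times> real \<times> real \<Rightarrow> _)"
    unfolding sectors_def by (rule continuous_map_snd)
  have t: "continuous_map ?X euclideanreal (\<lambda>x. fst (snd x))"
    and s: "continuous_map ?X euclideanreal (\<lambda>x. snd (snd x))"
    by (rule continuous_map_compose[OF snd, unfolded comp_def];
        simp add: continuous_on_fst continuous_on_snd continuous_on_id)+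
  have real: "continuous_map ?X euclideanreal
      (\<lambda>x. (1 - snd (snd x)) * (u (fst x) + v (fst x) * fst (snd x)))"
    by (intro continuous_intros disc s t) simp
  have "continuous_map euclideanreal (top_of_set (- {0}))
      (\<lambda>r. exp (2 * pi * \<i> * complex_of_real r))"
    by (auto simp: continuous_map_in_subtopology intro!: continuous_intros)
  from continuous_map_compose[OF real this] show ?thesis
    by (simp add: comp_def case_prod_unfold)
qed

text \<open>By \<open>pot\<close> the exponents of consecutive sectors of a face agree exactly, and
  the factor \<open>1 - s\<close> settles the centre. Across an edge, antisymmetry of
  \<open>\<phi>\<close> leaves an integer difference of exponents, which \<open>exp\<close> removes;
  hence the map descends to the quotient.\<close>

lemma surface_circle_map:
  fixes u \<phi> :: "'b \<Rightarrow> int"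
  assumes anti: "\<And>d. \<phi> (arev d) = - \<phi> d" and pot: "\<And>d. u (\<sigma> (arev d)) = u d + \<phi> d"
  obtains g where "continuous_map (surface G arev \<sigma>) (top_of_set (- {0 :: complex})) g"
    and "\<And>d (t :: real). d \<in> arcs G \<Longrightarrow> t \<in> {0..1} \<Longrightarrow>
           g (surface_point G arev \<sigma> (d, t, 0)) = exp (2 * pi * \<i> * of_real (\<phi> d * t))"
proof -
  define h where "h = (\<lambda>(d :: 'b, t, s). exp (2 * pi * \<i> *
      complex_of_real ((1 - s) * (real_of_int (u d) + real_of_int (\<phi> d) * t))))"
  have shift: "exp (2 * complex_of_real pi * \<i> * (of_int k + z)) = exp (2 * complex_of_real pi * \<i> * z)" for k :: int and z
    using exp_integer_2pi[of "of_int k"] by (simp add: distrib_left exp_add mult_ac)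
  have step: "h x = h y" if "(x, y) \<in> gluing G arev \<sigma>" for x y
  proof -
    have "h (d, t, 0) = h (arev d, 1 - t, 0)" for d t
    proof -
      have eq: "complex_of_int (u d) + of_int (\<phi> d) * of_real t = of_int (u d - u (arev d) + \<phi> d) +
          (of_int (u (arev d)) + of_int (\<phi> (arev d)) * of_real (1 - t))"
        by (simp add: anti algebra_simps)
      show ?thesis
        by (simp add: h_def eq shift del: of_int_add of_int_diff)
    qed
    with that show ?thesis
      by (auto simp: gluing_def) (auto simp: h_def pot)
  qed
  have "h x = h y" if "(x, y) \<in> glued G arev \<sigma>" for x y
  proof -
    have "(x, y) \<in> (gluing G arev \<sigma> \<union> (gluing G arev \<sigma>)\<inverse>)\<^sup>*"
      using that by (simp add: glued_def)
    then show ?thesis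
      by (induction rule: rtrancl_induct) (simp, metis step Un_iff converse_iff)
  qed
  then have "h x = h y" if "x \<in> topspace (sectors G)" "y \<in> topspace (sectors G)"
    "surface_point G arev \<sigma> x = surface_point G arev \<sigma> y" for x y
    using that eq_equiv_class[OF _ equiv_glued] unfolding surface_point_def topspace_sectors
    by metis
  with quotient_map_lift_exists[OF quotient_map_surface_point
      continuous_map_sectors[of "\<lambda>d. of_int (u d)" "\<lambda>d. of_int (\<phi> d)"]]
  obtain g where g: "continuous_map (surface G arev \<sigma>) (top_of_set (- {0})) g"
    "\<And>x. x \<in> sector_points G \<Longrightarrow> g (surface_point G arev \<sigma> x) = h x"
    unfolding h_def topspace_sectors by (metis (no_types, lifting))
  moreover have "h (d, t, 0) = exp (2 * pi * \<i> * of_real (\<phi> d * t))" for d and t :: real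
    using shift[of "u d" "of_real (\<phi> d * t)"] by (simp add: h_def)
  ultimately show ?thesis
    by (intro that) (auto simp: sector_points_def)
qed

text \<open>Comparing the two sides of the first edge is enough: the circle map then turns once
  along \<open>hd p\<close> and is constant on the rest of the cycle. \<open>side_cycle\<close>
  carries the conclusion to the other edges.\<close>

lemma contractible_imp_separating:
  assumes cyc: "simple_cycle G arev p" and contr: "contractible_walk G arev \<sigma> p"
  shows "(arev (hd p), hd p) \<notin> (side_step (set p \<union> arev ` set p))\<^sup>*"
proof
  let ?c = "hd p" and ?C = "set p \<union> arev ` set p"
  assume "(arev ?c, ?c) \<in> (side_step ?C)\<^sup>*"
  moreover have "arev d \<in> ?C" if "d \<in> ?C" for d
    using that by auto
  ultimately obtain u \<psi> :: "'b \<Rightarrow> int" where anti: "\<And>d. \<psi> (arev d) = - \<psi> d"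
    and zero: "\<And>d. d \<in> ?C \<Longrightarrow> \<psi> d = 0"
    and pot: "\<And>d. u (\<sigma> (arev d)) - u d = \<psi> d - of_bool (d = arev ?c) + of_bool (d = ?c)"
    using side_path_potential[of "arev ?c" ?c ?C] by blast
  \<comment> \<open>Crossing the edge of \<open>hd p\<close> closes up the path.\<close>
  define \<phi> where "\<phi> d = \<psi> d - of_bool (d = arev ?c) + of_bool (d = ?c)" for d
  have ne: "p \<noteq> []" and arcs: "set p \<subseteq> arcs G" and dist: "distinct (map (arc_edge arev) p)"
    using cyc by (auto simp: simple_cycle_def cycle_def)
  have hd: "?c = p ! 0" "?c \<in> arcs G"
    using ne arcs by (auto simp: hd_conv_nth)
  have \<phi>_hd: "\<phi> (p ! 0) = 1"
    using ne zero[of ?c] arev_neq[OF hd(2)] by (auto simp: \<phi>_def hd(1)[symmetric])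
  have \<phi>_other: "\<phi> (p ! i) = 0" if "0 < i" "i < length p" for i
  proof -
    have "arc_edge arev (p ! i) \<noteq> arc_edge arev (p ! 0)"
      using that ne nth_eq_iff_index_eq[OF dist, of i 0] by auto
    then have "p ! i \<noteq> ?c" "p ! i \<noteq> arev ?c"
      by (auto simp: arc_edge_def hd(1))
    with zero[of "p ! i"] that show ?thesis
      by (auto simp: \<phi>_def)
  qed
  obtain g where g: "continuous_map (surface G arev \<sigma>) (top_of_set (- {0 :: complex})) g"
    and g_edge: "\<And>d (t :: real). d \<in> arcs G \<Longrightarrow> t \<in> {0..1} \<Longrightarrow>
           g (surface_point G arev \<sigma> (d, t, 0)) = exp (2 * pi * \<i> * of_real (\<phi> d * t))"
  proof (rule surface_circle_map)
    show "\<phi> (arev d) = - \<phi> d" for d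
      by (auto simp: \<phi>_def anti arev_eq_iff)
    show "u (\<sigma> (arev d)) = u d + \<phi> d" for d
      using pot[of d] by (simp add: \<phi>_def)
  qed blast
  let ?w = "walk_curve G arev \<sigma> p"
  \<comment> \<open>A logarithm of the image curve: it rises to \<open>2 * pi * \<i>\<close> along
    the first arc, where \<open>\<phi>\<close> is 1, and then stays constant, since
    \<open>\<phi>\<close> is 0 on the later arcs.\<close>
  define q where "q x = 2 * pi * \<i> * complex_of_real (min 1 (x * length p))" for x :: real
  have gw: "g (?w x) = (exp \<circ> q) x" if "0 \<le> x" "x \<le> 1" for x
  proof -
    define y where "y = x * real (length p)"
    have y: "0 \<le> y" "y \<le> length p"
      using that ne by (auto simp: y_def mult_le_cancel_right1)
    let ?d = "p ! (nat \<lfloor>y\<rfloor> mod length p)"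
    have "?d \<in> arcs G"
      using ne arcs by (simp add: subset_iff)
    then have "g (?w x) = exp (2 * pi * \<i> * of_real (\<phi> ?d * frac y))"
      using g_edge[of ?d "frac y"] by (simp add: walk_curve_def y_def[symmetric] frac_lt_1 less_imp_le)
    also have "\<dots> = exp (2 * pi * \<i> * of_real (min 1 y))"
    proof (cases "y < 1")
      case True
      then have "\<lfloor>y\<rfloor> = 0"
        using y(1) by (simp add: floor_eq_iff)
      then show ?thesis
        using True by (simp add: \<phi>_hd frac_def)
    next
      case False
      have "real_of_int (\<phi> ?d) * frac y = 0"
      \<comment> \<open>At the endpoint the index wraps round to the first arc, where
        \<open>\<phi>\<close> is 1, but \<open>frac y\<close> is 0.\<close>
      proof (cases "y = length p")
        case True
        then show ?thesis by simp
      next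
        case False
        have "nat \<lfloor>y\<rfloor> < length p" "0 < nat \<lfloor>y\<rfloor>"
          using False \<open>\<not> y < 1\<close> y by linarith+
        then show ?thesis
          using \<phi>_other by simp
      qed
      then show ?thesis
        using False by (simp only: of_real_0 of_real_1 min_def) simp
    qed
    finally show ?thesis
      by (simp add: q_def y_def)
  qed
  obtain c where "homotopic_with (\<lambda>\<gamma>. \<gamma> 0 = \<gamma> 1) (top_of_set {0..1}) (surface G arev \<sigma>) ?w (\<lambda>_. c)"
    using contr by (auto simp: contractible_walk_def)
  \<comment> \<open>Composing with \<open>g\<close> carries the free homotopy of loops into the
    punctured plane, where it preserves winding numbers about 0.\<close>
  then have hom: "homotopic_loops (- {0}) (g \<circ> ?w) (\<lambda>_. g c)"
    unfolding homotopic_loops_def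
    by (rule homotopic_with_compose_continuous_map_left[OF _ g, THEN homotopic_with_eq[OF _ _ _ iffD1]])
      (auto simp: pathstart_def pathfinish_def)
  have "g c \<noteq> 0"
    using homotopic_loops_imp_subset[OF hom] by (auto simp: path_image_def)
  have "winding_number (g \<circ> ?w) 0 = winding_number (\<lambda>_. g c) 0"
    using hom by (rule winding_number_homotopic_loops)
  also have "\<dots> = 0"
    using \<open>g c \<noteq> 0\<close> by (intro winding_number_constI) auto
  also have "winding_number (g \<circ> ?w) 0 = winding_number (exp \<circ> q) 0"
    using gw by (intro winding_number_cong) auto
  also have "\<dots> = (pathfinish q - pathstart q) / (2 * of_real pi * \<i>)"
    unfolding q_def
    by (intro winding_number_compose_exp) (auto simp: path_def intro!: continuous_intros)
  also have "pathfinish q - pathstart q = 2 * pi * \<i>"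
    using ne by (cases p) (auto simp: q_def pathfinish_def pathstart_def)
  finally show False
    by simp
qed

section \<open>Flows as functions on arcs\<close>

text \<open>An antisymmetric function on arcs frees the flow from its orientation, so that signs can
  later be changed side by side. The deleted edge receives 0, which meets the bound because
  \<open>0 < n\<close>.\<close>

lemma circulation_of_flow:
  assumes e: "e \<in> edges G arev" and flow: "has_nowhere_zero_flow (del_edge G e) arev n"
    and n: "0 < n"
  obtains \<gamma> :: "'b \<Rightarrow> int"
  where "\<And>d. d \<in> arcs G \<Longrightarrow> \<gamma> (arev d) = - \<gamma> d"
    and "\<And>v. v \<in> verts G \<Longrightarrow> sum \<gamma> (out_arcs G v) = 0"
    and "\<And>d. d \<in> arcs G - e \<Longrightarrow> \<gamma> d \<noteq> 0"
    and "\<And>d. d \<in> arcs G \<Longrightarrow> \<bar>\<gamma> d\<bar> < int n"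
proof -
  let ?H = "del_edge G e"
  obtain Or f where or: "orientation ?H arev Or" and nz: "nowhere_zero_flow ?H arev n Or f"
    using flow by (auto simp: has_nowhere_zero_flow_def)
  obtain c where c: "c \<in> arcs G" "e = {c, arev c}"
    using e by (auto simp: edges_def arc_edge_def)
  have H: "arcs ?H = arcs G - e" "verts ?H = verts G" "tail ?H = tail G" "head ?H = head G"
    by (auto simp: del_edge_def)
  have Or_sub: "Or \<subseteq> arcs G - e"
    using or by (simp add: orientation_def H)
  have Or_iff: "arev d \<in> Or \<longleftrightarrow> d \<notin> Or" if "d \<in> arcs G - e" for d
    using or that by (auto simp: orientation_def H)
  have e_arev: "arev d \<in> e \<longleftrightarrow> d \<in> e" for d
    using c by (auto simp: arev_eq_iff)
  have edge_arev: "arc_edge arev (arev d) = arc_edge arev d" for d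
    by (auto simp: arc_edge_def)
  \<comment> \<open>Among the arcs of \<open>G\<close> the default 0 is reached exactly on
    \<open>e\<close>: for every other arc, \<open>d\<close> or \<open>arev d\<close> is in
    \<open>Or\<close>.\<close>
  define \<gamma> where "\<gamma> d = (if d \<in> Or then f (arc_edge arev d)
      else if arev d \<in> Or then - f (arc_edge arev d) else 0)" for d
  have \<gamma>_arc: "\<gamma> d \<noteq> 0 \<and> \<bar>\<gamma> d\<bar> < int n" if "d \<in> arcs G - e" for d
  proof -
    have "arc_edge arev d \<in> edges ?H arev"
      using that by (auto simp: edges_def H)
    then have "f (arc_edge arev d) \<noteq> 0 \<and> \<bar>f (arc_edge arev d)\<bar> < int n"
      using nz by (auto simp: nowhere_zero_flow_def)
    then show ?thesis
      using Or_iff[OF that] by (simp add: \<gamma>_def)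
  qed
  have \<gamma>_e: "\<gamma> d = 0" if "d \<in> e" for d
    using that e_arev[of d] Or_sub by (auto simp: \<gamma>_def)
  show thesis
  proof
    show "\<gamma> (arev d) = - \<gamma> d" if "d \<in> arcs G" for d
      using Or_iff[of d] that \<gamma>_e[of d] \<gamma>_e[of "arev d"] e_arev[of d]
      by (cases "d \<in> e") (auto simp: \<gamma>_def edge_arev)
    show "\<gamma> d \<noteq> 0" if "d \<in> arcs G - e" for d
      using \<gamma>_arc[OF that] by simp
    show "\<bar>\<gamma> d\<bar> < int n" if "d \<in> arcs G" for d
      using \<gamma>_arc[of d] \<gamma>_e[of d] that n by (cases "d \<in> e") auto
    show "sum \<gamma> (out_arcs G v) = 0" if v: "v \<in> verts G" for v
    proof -
      let ?out = "out_arcs G v \<inter> Or" and ?in = "in_arcs G v \<inter> Or"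
      have kirchhoff: "(\<Sum>d \<in> ?in. f (arc_edge arev d)) = (\<Sum>d \<in> ?out. f (arc_edge arev d))"
      proof -
        have "in_arcs ?H v \<inter> Or = ?in" "out_arcs ?H v \<inter> Or = ?out"
          using Or_sub by (auto simp: in_arcs_def out_arcs_def H)
        moreover have "(\<Sum>d \<in> in_arcs ?H v \<inter> Or. f (arc_edge arev d)) =
            (\<Sum>d \<in> out_arcs ?H v \<inter> Or. f (arc_edge arev d))"
          using nz v unfolding nowhere_zero_flow_def H by blast
        ultimately show ?thesis
          by simp
      qed
      \<comment> \<open>Oriented arcs entering \<open>v\<close> are counted through their reversals,
        which leave \<open>v\<close>; a loop outside \<open>e\<close> contributes once to each part.
        The arcs left over have value 0.\<close>
      have "sum \<gamma> (out_arcs G v) = sum \<gamma> (?out \<union> arev ` ?in)"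
      proof (rule sum.mono_neutral_right)
        show "?out \<union> arev ` ?in \<subseteq> out_arcs G v"
          by auto
        show "\<forall>d \<in> out_arcs G v - (?out \<union> arev ` ?in). \<gamma> d = 0"
        proof
          fix d assume d: "d \<in> out_arcs G v - (?out \<union> arev ` ?in)"
          have "arev d \<notin> Or"
          proof
            assume "arev d \<in> Or"
            with d have "arev d \<in> ?in"
              by simp
            then have "arev (arev d) \<in> arev ` ?in"
              by (rule imageI)
            with d show False
              by simp
          qed
          with d show "\<gamma> d = 0"
            by (simp add: \<gamma>_def)
        qed
      qed auto
      also have "\<dots> = sum \<gamma> ?out + sum \<gamma> (arev ` ?in)"
        by (rule sum.union_disjoint) (use Or_sub Or_iff in \<open>auto simp: subset_iff\<close>)
      also have "sum \<gamma> ?out = (\<Sum>d \<in> ?out. f (arc_edge arev d))"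
        by (rule sum.cong) (auto simp: \<gamma>_def)
      also have "sum \<gamma> (arev ` ?in) = (\<Sum>d \<in> ?in. \<gamma> (arev d))"
        by (rule sum.reindex_cong[OF _ refl refl]) (auto simp: inj_on_def arev_eq_iff)
      also have "\<dots> = - (\<Sum>d \<in> ?in. f (arc_edge arev d))"
        unfolding sum_negf[symmetric]
        by (rule sum.cong) (use Or_sub Or_iff in \<open>auto simp: \<gamma>_def edge_arev subset_iff\<close>)
      finally show ?thesis
        by (simp add: kirchhoff)
    qed
  qed
qed

lemma orientation_of_del_edge:
  assumes e: "e \<in> edges G arev" and or: "orientation (del_edge G e) arev Or"
  obtains Or' where "orientation G arev Or'"
proof -
  obtain c where c: "c \<in> arcs G" "e = {c, arev c}"
    using e by (auto simp: edges_def arc_edge_def)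
  have "orientation G arev (insert c Or)"
    using or c arev_neq[OF c(1)] by (auto simp: orientation_def del_edge_def arev_eq_iff)
  then show thesis ..
qed

text \<open>This lets the dihedral flow be built on arcs, with the orientation chosen only at the
  end.\<close>

lemma edge_map_of_half_edge_values:
  assumes M: "group M" and or: "orientation G arev Or"
    and W: "\<And>d. d \<in> arcs G \<Longrightarrow> W d \<in> carrier M"
    and inv: "\<And>d. d \<in> arcs G \<Longrightarrow> W (arev d) = inv\<^bsub>M\<^esub> W d"
  obtains f where "\<And>d. d \<in> arcs G \<Longrightarrow> half_edge_value M arev Or f d = W d"
    and "\<And>e. e \<in> edges G arev \<Longrightarrow> \<exists>d \<in> arcs G. f e = W d"
proof
  \<comment> \<open>Each edge has exactly one arc outside \<open>Or\<close>, and there the half-edge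
    value is the edge value without inversion.\<close>
  let ?f = "\<lambda>e. W (THE d. d \<in> e \<and> d \<notin> Or)"
  have *: "?f (arc_edge arev d) = (if d \<in> Or then W (arev d) else W d)" if "d \<in> arcs G" for d
  proof -
    have "d \<in> Or \<longleftrightarrow> arev d \<notin> Or"
      using or that unfolding orientation_def by blast
    then have "(THE x. x \<in> arc_edge arev d \<and> x \<notin> Or) = (if d \<in> Or then arev d else d)"
      by (intro the_equality) (auto simp: arc_edge_def)
    then show ?thesis
      by simp
  qed
  show "half_edge_value M arev Or ?f d = W d" if "d \<in> arcs G" for d
    using *[OF that] inv[OF that] group.inv_inv[OF M W[OF that]]
    by (simp add: half_edge_value_def)
  show "\<exists>d \<in> arcs G. ?f e = W d" if e: "e \<in> edges G arev" for e
  proof -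
    obtain d where "d \<in> arcs G" "e = arc_edge arev d"
      using e by (auto simp: edges_def)
    then show ?thesis
      using *[of d] arev_in_arcs[of d] by (cases "d \<in> Or") auto
  qed
qed

end

section \<open>Sides at the vertices of a separating cycle\<close>

text \<open>Inside this locale the topology of the surface enters only through
  \<open>separating\<close>; the rest is combinatorial.\<close>

locale separating_cycle = embedded_multigraph +
  fixes p :: "'b list"
  assumes cubic: "cubic G"
    and simple: "simple_cycle G arev p"
    and separating: "(arev (hd p), hd p) \<notin> (side_step (set p \<union> arev ` set p))\<^sup>*"
begin

definition cycle_darts :: "'b set" where
  "cycle_darts = set p \<union> arev ` set p"

definition side :: "'b \<Rightarrow> bool" where
  "side d \<longleftrightarrow> (arev (hd p), d) \<in> (side_step cycle_darts)\<^sup>*"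

lemma cycle_darts_arev [simp]: "arev d \<in> cycle_darts \<longleftrightarrow> d \<in> cycle_darts"
  unfolding cycle_darts_def by (metis Un_iff arev_arev image_iff)

text \<open>The corner between the consecutive half-edges \<open>d\<close> and
  \<open>\<sigma> d\<close> lies in one face, whose walk arrives by \<open>arev d\<close> and leaves
  by \<open>\<sigma> d\<close>.\<close>

lemma side_facial: "side (\<sigma> d) \<longleftrightarrow> side (arev d)"
proof -
  have "(arev d, \<sigma> d) \<in> side_step cycle_darts" "(\<sigma> d, arev d) \<in> side_step cycle_darts"
    by (auto simp: side_step_def)
  then show ?thesis
    unfolding side_def by (meson rtrancl.rtrancl_into_rtrancl)
qed

lemma side_arev:
  assumes "d \<notin> cycle_darts"
  shows "side (arev d) \<longleftrightarrow> side d"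
proof -
  have "(arev d, d) \<in> side_step cycle_darts" "(d, arev d) \<in> side_step cycle_darts"
    using assms by (auto simp: side_step_def)
  then show ?thesis
    unfolding side_def by (meson rtrancl.rtrancl_into_rtrancl)
qed

lemma rotation_triple:
  assumes "v \<in> verts G" "d \<in> out_arcs G v"
  shows "out_arcs G v = {d, \<sigma> d, \<sigma> (\<sigma> d)}" "\<sigma> (\<sigma> (\<sigma> d)) = d" "card (out_arcs G v) = 3"
proof -
  have cyc: "cyclic_on \<sigma> (out_arcs G v)"
    using assms rotation unfolding rotation_system_def by blast
  show card: "card (out_arcs G v) = 3"
    using assms cubic by (simp add: cubic_def out_degree_def)
  show "out_arcs G v = {d, \<sigma> d, \<sigma> (\<sigma> d)}" "\<sigma> (\<sigma> (\<sigma> d)) = d"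
    using cyclic_on_card_3[OF cyc card assms(2)] by auto
qed

lemma cycle_nonempty: "p \<noteq> []"
  and cycle_arcs: "set p \<subseteq> arcs G"
  and cycle_edges_distinct: "distinct (map (arc_edge arev) p)"
  using simple by (auto simp: simple_cycle_def cycle_def)

lemma cycle_head_nth:
  assumes "i < length p"
  shows "head G (p ! i) = tail G (p ! (Suc i mod length p))"
proof -
  obtain u where u: "cas u p u"
    using simple by (auto simp: simple_cycle_def cycle_def)
  \<comment> \<open>Two listings of the vertices of the walk; comparing entries at
    \<open>Suc i\<close> gives every case except the closing one.\<close>
  have eq: "tail G (hd p) # map (head G) p = map (tail G) p @ [head G (last p)]"
    using awalk_verts_conv'[OF u] awalk_verts_conv[of u p] cycle_nonempty by simp
  show ?thesis
  proof (cases "Suc i = length p")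
    case True
    have "head G (last p) = u" "tail G (hd p) = u"
      using awlast_if_cas[OF u] awhd_if_cas[OF u] cycle_nonempty
      by (simp_all add: awalk_verts_conv hd_append hd_map)
    moreover have "last p = p ! i" "hd p = p ! 0"
      using cycle_nonempty by (simp_all add: last_conv_nth hd_conv_nth True[symmetric])
    ultimately show ?thesis
      using True by simp
  next
    case False
    then show ?thesis
      using assms arg_cong[OF eq, of "\<lambda>xs. xs ! Suc i"] by (simp add: nth_append)
  qed
qed

lemma cycle_heads_distinct: "distinct (map (head G) p)"
proof -
  obtain u where "cas u p u" "distinct (tl (awalk_verts u p))"
    using simple by (auto simp: simple_cycle_def cycle_def)
  then show ?thesis
    using cycle_nonempty by (simp add: awalk_verts_conv')
qed

lemma cycle_pred:
  assumes "k < length p"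
  obtains i where "i < length p" "Suc i mod length p = k"
proof (cases k)
  case 0
  then show ?thesis
    using that[of "length p - 1"] assms by simp
next
  case (Suc i)
  then show ?thesis
    using that[of i] assms by simp
qed

lemma cycle_arev_disjoint:
  assumes "d \<in> set p"
  shows "arev d \<notin> set p"
proof
  assume "arev d \<in> set p"
  moreover have "arc_edge arev (arev d) = arc_edge arev d"
    by (auto simp: arc_edge_def)
  ultimately have "arev d = d"
    using assms cycle_edges_distinct by (auto simp: distinct_map inj_on_def)
  then show False
    using arev_neq assms cycle_arcs by blast
qed

text \<open>Heads along the cycle are distinct, so exactly one of its arcs enters \<open>v\<close>;
  a cycle dart at \<open>v\<close> is the reversal of that arc or its successor. If \<open>p\<close>
  is a loop, these are the two arcs of one edge.\<close>

lemma cycle_corner: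
  assumes "x \<in> out_arcs G v \<inter> cycle_darts"
  obtains i where "i < length p"
    and "out_arcs G v \<inter> cycle_darts = {arev (p ! i), p ! (Suc i mod length p)}"
proof -
  have arcs: "p ! k \<in> arcs G" if "k < length p" for k
    using that cycle_arcs by auto
  have "\<exists>i < length p. head G (p ! i) = v"
  proof (cases "x \<in> set p")
    case True
    then obtain k where "k < length p" "x = p ! k"
      by (auto simp: in_set_conv_nth)
    then show ?thesis
      using assms cycle_pred[of k] cycle_head_nth by (metis IntD1 in_out_arcs_conv)
  next
    case False
    then obtain k where "k < length p" "x = arev (p ! k)"
      using assms by (auto simp: cycle_darts_def in_set_conv_nth)
    then show ?thesis
      using assms arcs by auto
  qed
  then obtain i where i: "i < length p" "head G (p ! i) = v"
    by blast
  let ?j = "Suc i mod length p"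
  have j: "?j < length p" "tail G (p ! ?j) = v"
    using i cycle_head_nth[OF i(1)] cycle_nonempty by simp_all
  have heads: "k = i" if "k < length p" "head G (p ! k) = v" for k
    using nth_eq_iff_index_eq[OF cycle_heads_distinct, of k i] that i by simp
  have "out_arcs G v \<inter> cycle_darts \<subseteq> {arev (p ! i), p ! ?j}"
  proof
    fix y assume y: "y \<in> out_arcs G v \<inter> cycle_darts"
    show "y \<in> {arev (p ! i), p ! ?j}"
    proof (cases "y \<in> set p")
      case True
      then obtain k where k: "k < length p" "y = p ! k"
        by (auto simp: in_set_conv_nth)
      obtain m where m: "m < length p" "Suc m mod length p = k"
        using cycle_pred[OF k(1)] .
      then have "m = i"
        using heads[of m] cycle_head_nth[of m] y k by simp
      then show ?thesis
        using m k by simp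
    next
      case False
      then obtain k where k: "k < length p" "y = arev (p ! k)"
        using y by (auto simp: cycle_darts_def in_set_conv_nth)
      then show ?thesis
        using heads[of k] y arcs by simp
    qed
  qed
  moreover have "{arev (p ! i), p ! ?j} \<subseteq> out_arcs G v \<inter> cycle_darts"
    using i j arcs by (auto simp: cycle_darts_def)
  ultimately show thesis
    using that i(1) by blast
qed

text \<open>Degree 3 leaves one further half-edge \<open>t\<close>. The two possible cyclic orders
  record the side of the cycle to which \<open>t\<close> points.\<close>

lemma cycle_rotation:
  assumes v: "v \<in> verts G" and ab: "out_arcs G v \<inter> cycle_darts = {a, b}"
    and ne: "a \<noteq> b"
  obtains t where "t \<notin> cycle_darts" "out_arcs G v = {t, a, b}" "t \<noteq> a" "t \<noteq> b"
    and "\<sigma> t = a \<and> \<sigma> a = b \<and> \<sigma> b = t \<or> \<sigma> t = b \<and> \<sigma> b = a \<and> \<sigma> a = t"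
proof -
  have a: "a \<in> out_arcs G v"
    using ab by blast
  have "card (out_arcs G v) = 3"
    using rotation_triple(3)[OF v a] .
  moreover have "card (out_arcs G v \<inter> cycle_darts) = 2"
    using ab ne by simp
  ultimately have "out_arcs G v \<noteq> out_arcs G v \<inter> cycle_darts"
    by auto
  then obtain t where t: "t \<in> out_arcs G v" "t \<notin> cycle_darts"
    by blast
  note rot = rotation_triple[OF v t(1)]
  have t_ne: "t \<noteq> a" "t \<noteq> b"
    using t ab by blast+
  have "{a, b} \<subseteq> {t, \<sigma> t, \<sigma> (\<sigma> t)}"
    using ab rot(1) by blast
  with t_ne have "{a, b} \<subseteq> {\<sigma> t, \<sigma> (\<sigma> t)}"
    by blast
  then have "a = \<sigma> t \<and> b = \<sigma> (\<sigma> t) \<or> b = \<sigma> t \<and> a = \<sigma> (\<sigma> t)"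
    using ne by blast
  with t t_ne rot show thesis
    by (intro that[of t]) auto
qed

text \<open>On one side of the cycle the face turns directly through the corner of \<open>a\<close>
  and \<open>b\<close>; on the other, one passes from face to face across the edge of
  \<open>t\<close>, which is not on the cycle.\<close>

lemma side_cycle_corner:
  assumes v: "v \<in> verts G" and ab: "out_arcs G v \<inter> cycle_darts = {a, b}"
    and ne: "a \<noteq> b"
  shows "side (arev b) \<longleftrightarrow> side a" "side b \<longleftrightarrow> side (arev a)"
proof -
  obtain t where t: "t \<notin> cycle_darts"
    and rot: "\<sigma> t = a \<and> \<sigma> a = b \<and> \<sigma> b = t \<or> \<sigma> t = b \<and> \<sigma> b = a \<and> \<sigma> a = t"
    using cycle_rotation[OF v ab ne] .
  show "side (arev b) \<longleftrightarrow> side a" "side b \<longleftrightarrow> side (arev a)"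
    using rot side_facial[of t] side_facial[of a] side_facial[of b] side_arev[OF t] by auto
qed

lemma corner_distinct:
  assumes "i < length p" "j < length p"
  shows "arev (p ! i) \<noteq> p ! j"
  using assms cycle_arev_disjoint[of "p ! i"] by (metis nth_mem)

text \<open>Reflexivity and \<open>separating\<close> settle the first edge; the corner at each
  vertex passes the pattern on to the next arc.\<close>

lemma side_cycle:
  assumes "i < length p"
  shows "side (arev (p ! i)) \<and> \<not> side (p ! i)"
  using assms
proof (induction i)
  case 0
  show ?case
    using separating cycle_nonempty
    by (simp add: side_def cycle_darts_def hd_conv_nth)
next
  case (Suc i)
  let ?v = "head G (p ! i)"
  have i: "i < length p" "p ! i \<in> arcs G"
    using Suc.prems cycle_arcs by auto
  have "arev (p ! i) \<in> out_arcs G ?v \<inter> cycle_darts"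
    using i by (simp add: cycle_darts_def)
  \<comment> \<open>The corner comes with an unknown index \<open>k\<close>; distinctness of the
    heads identifies it with \<open>i\<close>.\<close>
  then obtain k where k: "k < length p"
    "out_arcs G ?v \<inter> cycle_darts = {arev (p ! k), p ! (Suc k mod length p)}"
    using cycle_corner by blast
  then have "arev (p ! i) \<in> {arev (p ! k), p ! (Suc k mod length p)}"
    using \<open>arev (p ! i) \<in> _\<close> by simp
  moreover have "arev (p ! i) \<noteq> p ! (Suc k mod length p)"
    using corner_distinct[OF i(1)] cycle_nonempty by simp
  ultimately have "p ! k = p ! i"
    by (metis arev_arev insertE singletonD)
  then have "k = i"
    using nth_eq_iff_index_eq[OF cycle_heads_distinct, of k i] k i by simp
  then have corner: "out_arcs G ?v \<inter> cycle_darts = {arev (p ! i), p ! Suc i}"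
    using k Suc.prems by simp
  show ?case
    using side_cycle_corner[OF _ corner corner_distinct[OF i(1) Suc.prems]] Suc i by simp
qed

section \<open>Construction of the dihedral flow\<close>

lemma dihedral_flow_exists:
  assumes e: "e \<in> edges G arev" and e_cycle: "e \<in> arc_edge arev ` set p"
    and flow: "has_nowhere_zero_flow (del_edge G e) arev n" and n: "0 < n"
  shows "has_nowhere_identity_dihedral_flow G arev \<sigma> n"
proof -
  let ?D = dihedral_group
  obtain \<gamma> :: "'b \<Rightarrow> int" where anti: "\<And>d. d \<in> arcs G \<Longrightarrow> \<gamma> (arev d) = - \<gamma> d"
    and kirchhoff: "\<And>v. v \<in> verts G \<Longrightarrow> sum \<gamma> (out_arcs G v) = 0"
    and nonzero: "\<And>d. d \<in> arcs G - e \<Longrightarrow> \<gamma> d \<noteq> 0"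
    and bound: "\<And>d. d \<in> arcs G \<Longrightarrow> \<bar>\<gamma> d\<bar> < int n"
    using circulation_of_flow[OF e flow n] by blast
  \<comment> \<open>Reflections are involutions, so their value does not depend on the direction of the edge;
    here it is the flow in the direction of \<open>p\<close>.\<close>
  define W where "W d = (if d \<in> cycle_darts
      then dihedral_matrix (- 1) (if d \<in> set p then \<gamma> d else - \<gamma> d)
      else dihedral_matrix 1 (if side d then - \<gamma> d else \<gamma> d))" for d
  have W_carrier: "W d \<in> carrier ?D" for d
    by (auto simp: W_def dihedral_group_def)
  have W_inv: "W (arev d) = inv\<^bsub>?D\<^esub> W d" if d: "d \<in> arcs G" for d
  proof (rule sym, rule group.inv_equality[OF group_dihedral_group _ W_carrier W_carrier])
    \<comment> \<open>On the cycle the sign rule cancels antisymmetry, so both arcs carry the same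
      reflection. Off the cycle both arcs lie on the same side and carry opposite
      translations.\<close>
    have "arev d \<in> set p \<longleftrightarrow> d \<notin> set p" if "d \<in> cycle_darts"
      using that cycle_arev_disjoint[of d] by (auto simp: cycle_darts_def)
    then show "W (arev d) \<otimes>\<^bsub>?D\<^esub> W d = \<one>\<^bsub>?D\<^esub>"
      using anti[OF d] side_arev[of d]
      by (auto simp: W_def dihedral_group_def dihedral_matrix_one dihedral_matrix_mult)
  qed
  have e_sub: "e \<subseteq> cycle_darts"
    using e_cycle by (auto simp: arc_edge_def cycle_darts_def)
  \<comment> \<open>This is where \<open>e\<close> must lie on the cycle: a reflection differs from
    the identity even when \<open>\<gamma>\<close> is 0, and the translations use only nonzero
    values.\<close>
  have W_ne: "W d \<noteq> \<one>\<^bsub>?D\<^esub>" if "d \<in> arcs G" for d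
    using that nonzero[of d] e_sub by (auto simp: W_def dihedral_group_def dihedral_matrix_one)
  have W_below: "W d \<in> dihedral_below n" if "d \<in> arcs G" for d
    using bound[OF that] by (auto simp: W_def dihedral_below_def)
  have vertex: "W d ** (W (\<sigma> d) ** W (\<sigma> (\<sigma> d))) = dihedral_matrix 1 0"
    if v: "v \<in> verts G" and d: "d \<in> out_arcs G v" for v d
  proof (cases "out_arcs G v \<inter> cycle_darts = {}")
    case True
    note rot = rotation_triple[OF v d]
    have out: "d \<notin> cycle_darts" "\<sigma> d \<notin> cycle_darts" "\<sigma> (\<sigma> d) \<notin> cycle_darts"
      using True rot(1) by auto
    \<comment> \<open>Away from the cycle all three half-edges lie on one side, so the common sign
      factors out of Kirchhoff's law.\<close>
    have "side (\<sigma> d) \<longleftrightarrow> side d" "side (\<sigma> (\<sigma> d)) \<longleftrightarrow> side d"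
      using side_facial side_arev out by blast+
    moreover have "\<gamma> d + \<gamma> (\<sigma> d) + \<gamma> (\<sigma> (\<sigma> d)) = 0"
    proof -
      have "distinct [d, \<sigma> d, \<sigma> (\<sigma> d)]"
        using rot(1,3) by (intro card_distinct) simp
      then show ?thesis
        using kirchhoff[OF v] by (simp add: rot(1))
    qed
    ultimately show ?thesis
      using out by (auto simp: W_def dihedral_matrix_mult)
  next
    case False
    then obtain x where "x \<in> out_arcs G v \<inter> cycle_darts"
      by blast
    then obtain i where i: "i < length p"
      and corner: "out_arcs G v \<inter> cycle_darts = {arev (p ! i), p ! (Suc i mod length p)}"
      using cycle_corner by blast
    define a b where "a = arev (p ! i)" and "b = p ! (Suc i mod length p)"
    have j: "Suc i mod length p < length p"
      using cycle_nonempty by simp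
    have b: "b \<in> set p" "b \<in> cycle_darts" and a: "a \<notin> set p" "a \<in> cycle_darts"
      using i j cycle_arev_disjoint by (auto simp: a_def b_def cycle_darts_def)
    then have ne: "a \<noteq> b"
      by blast
    have sides: "side a" "\<not> side (arev a)" "\<not> side b" "side (arev b)"
      using side_cycle[OF i] side_cycle[OF j] by (simp_all add: a_def b_def)
    obtain t where t: "t \<notin> cycle_darts" and out: "out_arcs G v = {t, a, b}" "t \<noteq> a" "t \<noteq> b"
      and rot: "\<sigma> t = a \<and> \<sigma> a = b \<and> \<sigma> b = t \<or> \<sigma> t = b \<and> \<sigma> b = a \<and> \<sigma> a = t"
      using cycle_rotation[OF v corner[folded a_def b_def] ne] .
    have sum: "\<gamma> t + \<gamma> a + \<gamma> b = 0"
      using kirchhoff[OF v] out ne by simp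
    have W: "W a = dihedral_matrix (- 1) (- \<gamma> a)" "W b = dihedral_matrix (- 1) (\<gamma> b)"
      "W t = dihedral_matrix 1 (if side t then - \<gamma> t else \<gamma> t)"
      using a b t by (simp_all add: W_def)
    have "d = t \<or> d = a \<or> d = b"
      using d out by simp
    from rot show ?thesis
    proof
      \<comment> \<open>Here \<open>W a ** W b\<close> is the translation by
        \<open>- \<gamma> a - \<gamma> b = \<gamma> t\<close>, so \<open>t\<close> has to carry
        \<open>- \<gamma> t\<close>; it lies on the negated side.\<close>
      assume r: "\<sigma> t = a \<and> \<sigma> a = b \<and> \<sigma> b = t"
      then have "side t"
        using side_facial[of b] sides by simp
      with \<open>d = t \<or> d = a \<or> d = b\<close> show ?thesis
        using sum r W by (elim disjE) (simp_all add: dihedral_matrix_mult)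
    next
      \<comment> \<open>In the opposite order \<open>W b ** W a\<close> is the translation by
        \<open>\<gamma> a + \<gamma> b = - \<gamma> t\<close>, and \<open>t\<close> keeps its
        sign.\<close>
      assume r: "\<sigma> t = b \<and> \<sigma> b = a \<and> \<sigma> a = t"
      then have "\<not> side t"
        using side_facial[of a] sides by simp
      with \<open>d = t \<or> d = a \<or> d = b\<close> show ?thesis
        using sum r W by (elim disjE) (simp_all add: dihedral_matrix_mult)
    qed
  qed
  obtain Or where or: "orientation G arev Or"
    using flow orientation_of_del_edge[OF e] by (auto simp: has_nowhere_zero_flow_def)
  obtain f where f: "\<And>d. d \<in> arcs G \<Longrightarrow> half_edge_value ?D arev Or f d = W d"
    and f_edge: "\<And>e. e \<in> edges G arev \<Longrightarrow> \<exists>d \<in> arcs G. f e = W d"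
    using edge_map_of_half_edge_values[where W = W, OF group_dihedral_group or W_carrier W_inv] by blast
  have "group_flow ?D G arev \<sigma> Or f"
    unfolding group_flow_def
  proof (intro conjI ballI)
    show "f e \<in> carrier ?D" if "e \<in> edges G arev" for e
      using f_edge[OF that] W_carrier by auto
    fix v d assume v: "v \<in> verts G" and d: "d \<in> out_arcs G v"
    have "{d, \<sigma> d, \<sigma> (\<sigma> d)} \<subseteq> arcs G"
      unfolding rotation_triple(1)[OF v d, symmetric] by auto
    moreover have "[0..<out_degree G v] = [0, 1, 2]"
      using rotation_triple(3)[OF v d] by (simp add: out_degree_def upt_rec)
    moreover have "x \<otimes>\<^bsub>?D\<^esub> y = x ** y" "\<one>\<^bsub>?D\<^esub> = mat 1" for x y
      by (simp_all add: dihedral_group_def)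
    ultimately show "foldr (\<lambda>i x. half_edge_value ?D arev Or f ((\<sigma> ^^ i) d) \<otimes>\<^bsub>?D\<^esub> x)
        [0..<out_degree G v] \<one>\<^bsub>?D\<^esub> = \<one>\<^bsub>?D\<^esub>"
      using vertex[OF v d]
      by (simp add: f numeral_2_eq_2 dihedral_matrix_one[symmetric])
  qed
  moreover have "nowhere_identity ?D G arev f"
    unfolding nowhere_identity_def using f_edge W_ne by metis
  moreover have "\<forall>e \<in> edges G arev. f e \<in> dihedral_below n"
    using f_edge W_below by metis
  ultimately show ?thesis
    using or by (auto simp: has_nowhere_identity_dihedral_flow_def)
qed

end

theorem theorem4p7:
  fixes G :: "('a, 'b) pre_digraph" and arev \<sigma> :: "'b \<Rightarrow> 'b"
    and n :: nat and e' :: "'b set"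
  assumes "n \<ge> 3"
    and "multigraph G arev"
    and "Digraph_Component.connected G"
    and "cubic G"
    and "e' \<in> edges G arev"
    and "has_nowhere_zero_flow (del_edge G e') arev n"
    and "rotation_system G \<sigma>"
    and "\<exists>p. simple_cycle G arev p \<and> contractible_walk G arev \<sigma> p \<and> e' \<in> arc_edge arev ` set p"
  shows "has_nowhere_identity_dihedral_flow G arev \<sigma> n"
proof -
  interpret embedded_multigraph G arev \<sigma>
    using assms(2,7)
    by (simp add: multigraph_def embedded_multigraph_def embedded_multigraph_axioms_def)
  obtain p where p: "simple_cycle G arev p" "contractible_walk G arev \<sigma> p"
    "e' \<in> arc_edge arev ` set p"
    using assms(8) by blast
  interpret separating_cycle G arev \<sigma> p
    using assms(4) p(1) contractible_imp_separating[OF p(1,2)] by unfold_locales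
  show ?thesis
    using dihedral_flow_exists[OF assms(5) p(3) assms(6)] assms(1) by simp
qed

end
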